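(* Let $(L,A,[\cdot,\cdots,\cdot],\rho)$ be an $n$-Lie Rinehart algebra, $(M,\psi)$ a representation of $L$, $\theta:\wedge^nL\to M$ a $2$-cocycle associated with $(M,\psi)$, and $f:L\to M$ a $1$-cochain. Define $$\theta_f(x_1,\cdots,x_n)=f([x_1,\cdots,x_n])-\sum_{i=1}^n(-1)^{n-i}\psi(x_1,\cdots,\widehat{x_i},\cdots,x_n)f(x_i),\qquad x_1,\cdots,x_n\in L,$$ and define the map $$\Phi:T_\theta(L)\to T_{\theta+\theta_f}(L),\qquad \Phi(x+m)=x+f(x)+m,\quad \forall x\in L,\ m\in M.$$ Then the pair $(\Phi,\mathrm{Id}_A)$ is an $n$-Lie Rinehart algebra isomorphism.
   Context: All vector spaces are over a field $\mathbb{K}$ of characteristic $0$, and $n\ge 2$ is a fixed integer. A hat denotes omission. $\mathrm{Der}(A)$ is the space of $\mathbb K$-linear derivations of $A$; $\mathrm{End}(M)$ is the space of $\mathbb K$-linear endomorphisms of $M$. An $n$-Lie algebra is a vector space $L$ with a skew-symmetric $n$-linear bracket $[\cdot,\cdots,\cdot]:\wedge^nL\to L$ satisfying $$[x_1,\cdots,x_{n-1},[y_1,\cdots,y_n]]=\sum_{i=1}^n[y_1,\cdots,y_{i-1},[x_1,\cdots,x_{n-1},y_i],y_{i+1},\cdots,y_n].$$ A representation of an $n$-Lie algebra $L$ on a vector space $M$ is a linear map $\rho:\wedge^{n-1}L\to\mathfrak{gl}(M)$ such that for all $x_i,y_i\in L$: $$\rho(x_1,\cdots,x_{n-1})\circ\rho(y_1,\cdots,y_{n-1})-\rho(y_1,\cdots,y_{n-1})\circ\rho(x_1,\cdots,x_{n-1})=\sum_{i=1}^{n-1}\rho(y_1,\cdots,y_{i-1},[x_1,\cdots,x_{n-1},y_i],y_{i+1},\cdots,y_{n-1}),$$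 $$\rho(x_1,\cdots,x_{n-2},[y_1,\cdots,y_n])=\sum_{i=1}^n(-1)^{n-i}\rho(y_1,\cdots,\widehat{y_i},\cdots,y_n)\circ\rho(x_1,\cdots,x_{n-2},y_i).$$ An $n$-Lie Rinehart algebra over $A$ is a tuple $(L,A,[\cdot,\cdots,\cdot],\rho)$ where $A$ is an associative commutative algebra, $L$ is an $A$-module, $[\cdot,\cdots,\cdot]$ is a skew-symmetric $n$-linear map $L\times\cdots\times L\to L$, and $\rho:\wedge^{n-1}L\to\mathrm{Der}(A)$ is a linear map, such that: (1) $(L,[\cdot,\cdots,\cdot])$ is an $n$-Lie algebra; (2) $\rho$ is a representation of $(L,[\cdot,\cdots,\cdot])$ on $A$; (3) $\rho(ax_1,x_2,\cdots,x_{n-1})=a\rho(x_1,\cdots,x_{n-1})$; (4) $[x_1,\cdots,x_{n-1},ax_n]=a[x_1,\cdots,x_n]+\rho(x_1,\cdots,x_{n-1})(a)\,x_n$, for all $x_i\in L$, $a\in A$. A representation of the $n$-Lie Rinehart algebra $(L,A,[\cdot,\cdots,\cdot],\rho)$ is a pair $(M,\psi)$, with $M$ an $A$-module and $\psi:\wedge^{n-1}L\to\mathrm{End}(M)$ linear, such that: (1) $\psi$ is a representation of the $n$-Lie algebra $(L,[\cdot,\cdots,\cdot])$ on $M$; (2) $\psi(ax_1,x_2,\cdots,x_{n-1})=a\psi(x_1,\cdots,x_{n-1})$; (3) $\psi(x_1,\cdots,x_{n-1})(am)=a\psi(x_1,\cdots,x_{n-1})(m)+\rho(x_1,\cdots,x_{n-1})(a)\,m$,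 for all $x_i\in L$, $a\in A$, $m\in M$. A $1$-cochain is an $A$-linear map $f:L\to M$. A $2$-cochain is a linear map $\theta:\wedge^nL\to M$ (skew-symmetric) that is $A$-linear in each argument. A $2$-cocycle associated with $(M,\psi)$ is a $2$-cochain $\theta$ satisfying, for all $x_i,y_i\in L$, $$\theta(y_1,\cdots,y_{n-1},[x_1,\cdots,x_n])=\sum_{i=1}^n\theta(x_1,\cdots,[y_1,\cdots,y_{n-1},x_i],\cdots,x_n)+\sum_{i=1}^n(-1)^{n-i}\psi(x_1,\cdots,\widehat{x_i},\cdots,x_n)\theta(y_1,\cdots,y_{n-1},x_i)-\psi(y_1,\cdots,y_{n-1})\theta(x_1,\cdots,x_n).$$ For a $2$-cocycle $\theta$, the $T_\theta$-extension $T_\theta(L)$ of $L$ by $M$ is the $n$-Lie Rinehart algebra $(L\oplus M,A,[\cdot,\cdots,\cdot]_\theta,\rho_\theta)$ with $A$-action $a(x+m)=ax+am$, bracket $$[x_1+m_1,\cdots,x_n+m_n]_\theta=[x_1,\cdots,x_n]+\theta(x_1,\cdots,x_n)+\sum_{i=1}^n(-1)^{n-i}\psi(x_1,\cdots,\widehat{x_i},\cdots,x_n)m_i,$$ and $\rho_\theta(x_1+m_1,\cdots,x_{n-1}+m_{n-1})=\rho(x_1,\cdots,x_{n-1})$. (The map $\theta_f$ is itself a $2$-cocycle, so $\theta+\theta_f$ is one and $T_{\theta+\theta_f}(L)$ is defined in the same way.) A homomorphism of $n$-Lie Rinehart algebras from $(L,A,[\cdot,\cdots,\cdot]_L,\rho)$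 to $(L',A',[\cdot,\cdots,\cdot]_{L'},\rho')$ consists of a $\mathbb K$-algebra homomorphism $g:A\to A'$ and an $n$-Lie algebra homomorphism $\phi:L\to L'$ (a linear map with $\phi([x_1,\cdots,x_n]_L)=[\phi(x_1),\cdots,\phi(x_n)]_{L'}$) such that $\phi(ax)=g(a)\phi(x)$ and $g(\rho(x_1,\cdots,x_{n-1})(a))=\rho'(\phi(x_1),\cdots,\phi(x_{n-1}))(g(a))$ for all $x,x_i\in L$, $a\in A$. It is an isomorphism if both maps are bijective. In the pair $(\Phi,\mathrm{Id}_A)$, $\phi=\Phi$ and $g=\mathrm{Id}_A$. *)

theory Defs
  imports Complex_Main "HOL-Library.Product_Plus"
begin

text \<open>
  Conventions. Vector spaces are types of class \<open>ab_group_add\<close> with an explicit scalar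
  multiplication over \<open>'k :: field_char_0\<close>. A map of \<open>k\<close> arguments is a function on lists, of which
  only the values on lists of length \<open>k\<close> matter. List positions are counted from \<open>0\<close>, so the sign
  \<open>(-1)^(n-i)\<close> of a sum over \<open>i = 1, ..., n\<close> becomes \<open>(-1)^(n - Suc i)\<close> with \<open>i < n\<close>.
  A linear map on the \<open>k\<close>-th exterior power is a skew-symmetric \<open>k\<close>-linear map.
\<close>

definition omit :: "nat \<Rightarrow> 'x list \<Rightarrow> 'x list" where
  "omit i xs = take i xs @ drop (Suc i) xs"

definition multilinear ::
  "nat \<Rightarrow> ('k::field_char_0 \<Rightarrow> 'v::ab_group_add \<Rightarrow> 'v) \<Rightarrow> ('k \<Rightarrow> 'w::ab_group_add \<Rightarrow> 'w)
    \<Rightarrow> ('v list \<Rightarrow> 'w) \<Rightarrow> bool" where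
  "multilinear k s t F \<longleftrightarrow>
    (\<forall>xs i. length xs = k \<longrightarrow> i < k \<longrightarrow> Vector_Spaces.linear s t (\<lambda>z. F (xs[i := z])))"

definition skew_symmetric :: "nat \<Rightarrow> ('v list \<Rightarrow> 'w::ab_group_add) \<Rightarrow> bool" where
  "skew_symmetric k F \<longleftrightarrow>
    (\<forall>xs i j. length xs = k \<longrightarrow> i < k \<longrightarrow> j < k \<longrightarrow> i \<noteq> j \<longrightarrow>
      F (xs[i := xs ! j, j := xs ! i]) = - F xs)"

locale n_Lie_algebra = L: vector_space sL
  for n :: nat and sL :: "'k::field_char_0 \<Rightarrow> 'l::ab_group_add \<Rightarrow> 'l" and br :: "'l list \<Rightarrow> 'l" +
  assumes br_multilinear: "multilinear n sL sL br"
    and br_skew: "skew_symmetric n br"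
    and br_fundamental: "\<And>xs ys. length xs = n - 1 \<Longrightarrow> length ys = n \<Longrightarrow>
      br (xs @ [br ys]) = (\<Sum>i<n. br (ys[i := br (xs @ [ys ! i])]))"

locale n_Lie_rep = L: n_Lie_algebra n sL br + M: vector_space sM
  for n :: nat and sL :: "'k::field_char_0 \<Rightarrow> 'l::ab_group_add \<Rightarrow> 'l" and br :: "'l list \<Rightarrow> 'l"
    and sM :: "'k \<Rightarrow> 'm::ab_group_add \<Rightarrow> 'm" and psi :: "'l list \<Rightarrow> 'm \<Rightarrow> 'm" +
  assumes psi_linear: "\<And>xs. length xs = n - 1 \<Longrightarrow> Vector_Spaces.linear sM sM (psi xs)"
    and psi_multilinear: "\<And>m. multilinear (n - 1) sL sM (\<lambda>xs. psi xs m)"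
    and psi_skew: "\<And>m. skew_symmetric (n - 1) (\<lambda>xs. psi xs m)"
    and psi_commutator: "\<And>xs ys m. length xs = n - 1 \<Longrightarrow> length ys = n - 1 \<Longrightarrow>
      psi xs (psi ys m) - psi ys (psi xs m) = (\<Sum>i<n - 1. psi (ys[i := br (xs @ [ys ! i])]) m)"
    and psi_bracket: "\<And>xs ys m. length xs = n - 2 \<Longrightarrow> length ys = n \<Longrightarrow>
      psi (xs @ [br ys]) m =
        (\<Sum>i<n. sM ((- 1) ^ (n - Suc i)) (psi (omit i ys) (psi (xs @ [ys ! i]) m)))"

text \<open>An associative commutative algebra, not assumed to have a unit.\<close>

locale comm_algebra = vector_space sA
  for sA :: "'k::field_char_0 \<Rightarrow> 'a::comm_ring \<Rightarrow> 'a" +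
  assumes scale_mult: "\<And>c a b. sA c (a * b) = sA c a * b"

definition derivation :: "('k::field_char_0 \<Rightarrow> 'a::comm_ring \<Rightarrow> 'a) \<Rightarrow> ('a \<Rightarrow> 'a) \<Rightarrow> bool" where
  "derivation sA D \<longleftrightarrow>
    Vector_Spaces.linear sA sA D \<and> (\<forall>a b. D (a * b) = D a * b + a * D b)"

text \<open>If the algebra does have a unit, its modules are required to be unital.\<close>

locale algebra_module = A: comm_algebra sA + V: vector_space sV
  for sA :: "'k::field_char_0 \<Rightarrow> 'a::comm_ring \<Rightarrow> 'a"
    and sV :: "'k \<Rightarrow> 'v::ab_group_add \<Rightarrow> 'v" and act :: "'a \<Rightarrow> 'v \<Rightarrow> 'v" +
  assumes act_add_left: "\<And>a b v. act (a + b) v = act a v + act b v"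
    and act_add_right: "\<And>a v w. act a (v + w) = act a v + act a w"
    and act_scale_left: "\<And>c a v. act (sA c a) v = sV c (act a v)"
    and act_scale_right: "\<And>c a v. act a (sV c v) = sV c (act a v)"
    and act_mult: "\<And>a b v. act (a * b) v = act a (act b v)"
    and act_unit: "\<And>e v. (\<forall>a. e * a = a) \<Longrightarrow> act e v = v"

record ('k, 'a, 'l) lie_rinehart =
  scaleA :: "'k \<Rightarrow> 'a \<Rightarrow> 'a"
  scaleL :: "'k \<Rightarrow> 'l \<Rightarrow> 'l"
  actL :: "'a \<Rightarrow> 'l \<Rightarrow> 'l"
  bracket :: "'l list \<Rightarrow> 'l"
  anchor :: "'l list \<Rightarrow> 'a \<Rightarrow> 'a"

record ('k, 'a, 'l, 'm) lie_rinehart_rep =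
  scaleM :: "'k \<Rightarrow> 'm \<Rightarrow> 'm"
  actM :: "'a \<Rightarrow> 'm \<Rightarrow> 'm"
  action :: "'l list \<Rightarrow> 'm \<Rightarrow> 'm"

locale n_Lie_Rinehart =
    algebra_module "scaleA R" "scaleL R" "actL R" +
    n_Lie_rep n "scaleL R" "bracket R" "scaleA R" "anchor R"
  for n :: nat and R :: "('k::field_char_0, 'a::comm_ring, 'l::ab_group_add) lie_rinehart" +
  assumes anchor_derivation: "\<And>xs. length xs = n - 1 \<Longrightarrow> derivation (scaleA R) (anchor R xs)"
    and anchor_act: "\<And>a b x xs. length (x # xs) = n - 1 \<Longrightarrow>
      anchor R (actL R a x # xs) b = a * anchor R (x # xs) b"
    and bracket_act: "\<And>a x xs. length xs = n - 1 \<Longrightarrow>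
      bracket R (xs @ [actL R a x]) = actL R a (bracket R (xs @ [x])) + actL R (anchor R xs a) x"

locale n_Lie_Rinehart_rep =
    R: n_Lie_Rinehart n R +
    M: algebra_module "scaleA R" "scaleM P" "actM P" +
    P: n_Lie_rep n "scaleL R" "bracket R" "scaleM P" "action P"
  for n :: nat and R :: "('k::field_char_0, 'a::comm_ring, 'l::ab_group_add) lie_rinehart"
    and P :: "('k, 'a, 'l, 'm::ab_group_add) lie_rinehart_rep" +
  assumes action_act: "\<And>a m x xs. length (x # xs) = n - 1 \<Longrightarrow>
      action P (actL R a x # xs) m = actM P a (action P (x # xs) m)"
    and action_leibniz: "\<And>a m xs. length xs = n - 1 \<Longrightarrow>
      action P xs (actM P a m) = actM P a (action P xs m) + actM P (anchor R xs a) m"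

definition cochain1 ::
  "('k::field_char_0, 'a::comm_ring, 'l::ab_group_add) lie_rinehart
    \<Rightarrow> ('k, 'a, 'l, 'm::ab_group_add) lie_rinehart_rep \<Rightarrow> ('l \<Rightarrow> 'm) \<Rightarrow> bool" where
  "cochain1 R P f \<longleftrightarrow>
    Vector_Spaces.linear (scaleL R) (scaleM P) f \<and> (\<forall>a x. f (actL R a x) = actM P a (f x))"

definition cochain2 ::
  "nat \<Rightarrow> ('k::field_char_0, 'a::comm_ring, 'l::ab_group_add) lie_rinehart
    \<Rightarrow> ('k, 'a, 'l, 'm::ab_group_add) lie_rinehart_rep \<Rightarrow> ('l list \<Rightarrow> 'm) \<Rightarrow> bool" where
  "cochain2 n R P \<theta> \<longleftrightarrow>
    multilinear n (scaleL R) (scaleM P) \<theta> \<and> skew_symmetric n \<theta> \<and>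
    (\<forall>xs i a. length xs = n \<longrightarrow> i < n \<longrightarrow> \<theta> (xs[i := actL R a (xs ! i)]) = actM P a (\<theta> xs))"

definition cocycle2 ::
  "nat \<Rightarrow> ('k::field_char_0, 'a::comm_ring, 'l::ab_group_add) lie_rinehart
    \<Rightarrow> ('k, 'a, 'l, 'm::ab_group_add) lie_rinehart_rep \<Rightarrow> ('l list \<Rightarrow> 'm) \<Rightarrow> bool" where
  "cocycle2 n R P \<theta> \<longleftrightarrow>
    cochain2 n R P \<theta> \<and>
    (\<forall>xs ys. length xs = n \<longrightarrow> length ys = n - 1 \<longrightarrow>
      \<theta> (ys @ [bracket R xs]) =
        (\<Sum>i<n. \<theta> (xs[i := bracket R (ys @ [xs ! i])])) +
        (\<Sum>i<n. scaleM P ((- 1) ^ (n - Suc i)) (action P (omit i xs) (\<theta> (ys @ [xs ! i])))) -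
        action P ys (\<theta> xs))"

definition theta_f ::
  "nat \<Rightarrow> ('k::field_char_0, 'a::comm_ring, 'l::ab_group_add) lie_rinehart
    \<Rightarrow> ('k, 'a, 'l, 'm::ab_group_add) lie_rinehart_rep \<Rightarrow> ('l \<Rightarrow> 'm) \<Rightarrow> 'l list \<Rightarrow> 'm" where
  "theta_f n R P f xs =
    f (bracket R xs) -
    (\<Sum>i<n. scaleM P ((- 1) ^ (n - Suc i)) (action P (omit i xs) (f (xs ! i))))"

text \<open>The direct sum is the product type: \<open>x + m\<close> is the pair \<open>(x, m)\<close>.\<close>

definition T_extension ::
  "nat \<Rightarrow> ('k::field_char_0, 'a::comm_ring, 'l::ab_group_add) lie_rinehart
    \<Rightarrow> ('k, 'a, 'l, 'm::ab_group_add) lie_rinehart_rep \<Rightarrow> ('l list \<Rightarrow> 'm)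
    \<Rightarrow> ('k, 'a, 'l \<times> 'm) lie_rinehart" where
  "T_extension n R P \<theta> =
    \<lparr>scaleA = scaleA R,
     scaleL = (\<lambda>c. map_prod (scaleL R c) (scaleM P c)),
     actL = (\<lambda>a. map_prod (actL R a) (actM P a)),
     bracket = (\<lambda>xms.
       (bracket R (map fst xms),
        \<theta> (map fst xms) +
        (\<Sum>i<n. scaleM P ((- 1) ^ (n - Suc i)) (action P (omit i (map fst xms)) (snd (xms ! i)))))),
     anchor = (\<lambda>xms. anchor R (map fst xms))\<rparr>"

definition n_Lie_Rinehart_hom ::
  "nat \<Rightarrow> ('k::field_char_0, 'a::comm_ring, 'l::ab_group_add) lie_rinehart
    \<Rightarrow> ('k, 'b::comm_ring, 'h::ab_group_add) lie_rinehart
    \<Rightarrow> ('l \<Rightarrow> 'h) \<Rightarrow> ('a \<Rightarrow> 'b) \<Rightarrow> bool" where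
  "n_Lie_Rinehart_hom n R R' \<phi> g \<longleftrightarrow>
    n_Lie_Rinehart n R \<and> n_Lie_Rinehart n R' \<and>
    Vector_Spaces.linear (scaleA R) (scaleA R') g \<and> (\<forall>a b. g (a * b) = g a * g b) \<and>
    Vector_Spaces.linear (scaleL R) (scaleL R') \<phi> \<and>
    (\<forall>xs. length xs = n \<longrightarrow> \<phi> (bracket R xs) = bracket R' (map \<phi> xs)) \<and>
    (\<forall>a x. \<phi> (actL R a x) = actL R' (g a) (\<phi> x)) \<and>
    (\<forall>xs a. length xs = n - 1 \<longrightarrow> g (anchor R xs a) = anchor R' (map \<phi> xs) (g a))"

text \<open>Bijectivity of \<open>g\<close> makes it preserve a unit, if there is one.\<close>

definition n_Lie_Rinehart_iso ::
  "nat \<Rightarrow> ('k::field_char_0, 'a::comm_ring, 'l::ab_group_add) lie_rinehart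
    \<Rightarrow> ('k, 'b::comm_ring, 'h::ab_group_add) lie_rinehart
    \<Rightarrow> ('l \<Rightarrow> 'h) \<Rightarrow> ('a \<Rightarrow> 'b) \<Rightarrow> bool" where
  "n_Lie_Rinehart_iso n R R' \<phi> g \<longleftrightarrow> n_Lie_Rinehart_hom n R R' \<phi> g \<and> bij \<phi> \<and> bij g"

end

theory Submission imports Defs begin

text \<open>
  The terms of the fundamental identity of \<open>T\<^sub>\<theta>(L)\<close> separate into those in \<open>\<theta>\<close>, which cancel by
  the cocycle identity, those in the \<open>M\<close>-components of the first \<open>n - 1\<close> arguments, which cancel by the
  second axiom of a representation, and those in the \<open>M\<close>-components of the bracketed arguments,
  which cancel by the first. By the choice of \<open>\<theta>\<^sub>f\<close>, the linear bijection \<open>\<Phi>\<close> carries the bracket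
  of \<open>T\<^sub>\<theta>(L)\<close> to that of \<open>T\<^bsub>\<theta>+\<theta>\<^sub>f\<^esub>(L)\<close>. Hence the latter is an \<open>n\<close>-Lie Rinehart algebra by transport
  of structure, and \<open>\<theta>\<^sub>f\<close> need not be shown to be a cocycle.
\<close>

section \<open>Lists with an omitted entry, and transpositions of entries\<close>

lemma length_omit [simp]: "i < length xs \<Longrightarrow> length (omit i xs) = length xs - 1"
  by (auto simp: omit_def)

lemma map_omit: "map g (omit i xs) = omit i (map g xs)"
  by (simp add: omit_def take_map drop_map)

lemma omit_append [simp]: "i < length xs \<Longrightarrow> omit i (xs @ ys) = omit i xs @ ys"
  by (simp add: omit_def)

lemma omit_last [simp]: "i = length xs \<Longrightarrow> omit i (xs @ [y]) = xs"
  by (simp add: omit_def)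

lemma omit_update_same [simp]: "omit i (xs[i := z]) = omit i xs"
  by (simp add: omit_def)

lemma nth_omit:
  assumes "i < length xs" and "j < length xs - 1"
  shows "omit i xs ! j = xs ! (if j < i then j else Suc j)"
  using assms by (auto simp: omit_def nth_append min_def)

text \<open>Deleting entry \<open>j\<close> moves every later entry down by one position, which
  decides between \<open>i\<close> and \<open>i - 1\<close>.\<close>

lemma omit_update:
  assumes "i \<noteq> j" and "i < length xs" and "j < length xs"
  shows "omit j (xs[i := z]) = (omit j xs)[(if i < j then i else i - 1) := z]"
  using assms by (intro nth_equalityI) (auto simp: nth_omit nth_list_update)

text \<open>Only one of the two neighbours survives the deletion, and it stands in the same place in
  both lists, so the remaining entries need no reordering. This is why \<open>alt_sum_skew\<close>
  works with adjacent transpositions.\<close>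

lemma omit_swap_adjacent:
  assumes "Suc i < length xs"
  shows "omit i (xs[i := xs ! Suc i, Suc i := xs ! i]) = omit (Suc i) xs"
    and "omit (Suc i) (xs[i := xs ! Suc i, Suc i := xs ! i]) = omit i xs"
  using assms by (intro nth_equalityI; auto simp: nth_omit nth_list_update less_Suc_eq)+

text \<open>The index map lists the positions other than \<open>k\<close> in increasing order. It
  converts positions in \<open>omit k ys\<close> into positions in \<open>ys\<close>.\<close>

lemma sum_skip:
  fixes g :: "nat \<Rightarrow> 'b::comm_monoid_add"
  assumes "k < n"
  shows "(\<Sum>l<n - 1. g (if l < k then l else Suc l)) = (\<Sum>i\<in>{..<n} - {k}. g i)"
  using assms
  by (intro sum.reindex_bij_witness[where j = "\<lambda>l. if l < k then l else Suc l"
        and i = "\<lambda>i. if i < k then i else i - 1"]) auto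

text \<open>Conjugating the transposition of \<open>i\<close> and \<open>j\<close> by that of
  \<open>j\<close> and \<open>Suc j\<close> gives the one of \<open>i\<close> and
  \<open>Suc j\<close>. Three sign changes amount to one, so induction on the distance between the
  positions applies.\<close>

lemma skew_symmetricI_adjacent:
  fixes F :: "'v list \<Rightarrow> 'w::ab_group_add"
  assumes adj: "\<And>xs i. length xs = k \<Longrightarrow> Suc i < k \<Longrightarrow>
      F (xs[i := xs ! Suc i, Suc i := xs ! i]) = - F xs"
  shows "skew_symmetric k F"
proof -
  \<comment> \<open>\<open>d\<close> counts the entries strictly between the two positions, so
    \<open>d = 0\<close> is the adjacent case.\<close>
  have less: "F (xs[i := xs ! (i + Suc d), (i + Suc d) := xs ! i]) = - F xs"
    if "length xs = k" "i + Suc d < k" for xs i d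
    using that
  proof (induction d arbitrary: xs)
    case 0
    then show ?case using adj[of xs i] by simp
  next
    case (Suc d)
    let ?j = "i + Suc d"
    define ys where "ys = xs[?j := xs ! Suc ?j, Suc ?j := xs ! ?j]"
    define zs where "zs = ys[i := ys ! ?j, ?j := ys ! i]"
    have len: "length ys = k" "length zs = k"
      using Suc.prems by (simp_all add: ys_def zs_def)
    have "xs[i := xs ! Suc ?j, Suc ?j := xs ! i] = zs[?j := zs ! Suc ?j, Suc ?j := zs ! ?j]"
      using Suc.prems by (intro nth_equalityI) (auto simp: ys_def zs_def nth_list_update)
    also have "F \<dots> = - F zs" using adj[of zs ?j] len Suc.prems by simp
    also have "F zs = - F ys" using Suc.IH[of ys] len Suc.prems by (simp add: zs_def)
    also have "F ys = - F xs" using adj[of xs ?j] Suc.prems by (simp add: ys_def)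
    finally show ?case by simp
  qed
  show ?thesis unfolding skew_symmetric_def
  proof (intro allI impI)
    fix xs :: "'v list" and i j
    assume *: "length xs = k" "i < k" "j < k" "i \<noteq> j"
    show "F (xs[i := xs ! j, j := xs ! i]) = - F xs"
    proof (cases "i < j")
      case True
      then show ?thesis using less[of xs i "j - i - 1"] * by simp
    next
      case False
      then show ?thesis using less[of xs j "i - j - 1"] * by (simp add: list_update_swap)
    qed
  qed
qed

section \<open>Linear, multilinear and skew-symmetric maps\<close>

lemma multilinearD:
  "multilinear k s t F \<Longrightarrow> length xs = k \<Longrightarrow> i < k \<Longrightarrow> Vector_Spaces.linear s t (\<lambda>z. F (xs[i := z]))"
  by (simp add: multilinear_def)

lemma skew_symmetricD:
  "skew_symmetric k F \<Longrightarrow> length xs = k \<Longrightarrow> i < k \<Longrightarrow> j < k \<Longrightarrow> i \<noteq> j \<Longrightarrow>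
    F (xs[i := xs ! j, j := xs ! i]) = - F xs"
  by (simp add: skew_symmetric_def)

lemma vector_space_map_prod:
  assumes "vector_space s" and "vector_space t"
  shows "vector_space (\<lambda>c. map_prod (s c) (t c))"
  using assms by (simp add: vector_space_def prod_eq_iff)

lemma linear_fst:
  assumes "vector_space s" and "vector_space t"
  shows "Vector_Spaces.linear (\<lambda>c. map_prod (s c) (t c)) s fst"
  using assms vector_space_map_prod[OF assms] by (simp add: Vector_Spaces.linear_iff)

lemma linear_snd:
  assumes "vector_space s" and "vector_space t"
  shows "Vector_Spaces.linear (\<lambda>c. map_prod (s c) (t c)) t snd"
  using assms vector_space_map_prod[OF assms] by (simp add: Vector_Spaces.linear_iff)

lemma linear_comp:
  "Vector_Spaces.linear s t g \<Longrightarrow> Vector_Spaces.linear t u h \<Longrightarrow> Vector_Spaces.linear s u (\<lambda>x. h (g x))"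
  by (simp add: Vector_Spaces.linear_iff)

lemma multilinear_map:
  fixes g :: "'x::ab_group_add \<Rightarrow> 'v::ab_group_add"
  assumes "multilinear k s t F" and "Vector_Spaces.linear s' s g"
  shows "multilinear k s' t (\<lambda>xs. F (map g xs))"
  unfolding multilinear_def
proof (intro allI impI)
  fix xs :: "'x list" and i
  assume "length xs = k" "i < k"
  then show "Vector_Spaces.linear s' t (\<lambda>z. F (map g (xs[i := z])))"
    using linear_comp[OF assms(2) multilinearD[OF assms(1), of "map g xs" i]] by (simp add: map_update)
qed

lemma skew_symmetric_map:
  assumes "skew_symmetric k F"
  shows "skew_symmetric k (\<lambda>xs. F (map g xs))"
  unfolding skew_symmetric_def
proof (intro allI impI)
  fix xs :: "'c list" and i j
  assume "length xs = k" "i < k" "j < k" "i \<noteq> j"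
  then show "F (map g (xs[i := xs ! j, j := xs ! i])) = - F (map g xs)"
    using skew_symmetricD[OF assms, of "map g xs" i j] by (simp add: map_update)
qed

lemma linear_sum_fun:
  assumes "vector_space s" and "vector_space t"
    and "\<And>i. i \<in> I \<Longrightarrow> Vector_Spaces.linear s t (F i)"
  shows "Vector_Spaces.linear s t (\<lambda>x. \<Sum>i\<in>I. F i x)"
  using assms
  by (simp add: Vector_Spaces.linear_iff sum.distrib module.scale_sum_right module_iff_vector_space)

section \<open>The bracket on the direct sum and its fundamental identity\<close>

context n_Lie_rep
begin

lemma psi_add: "length xs = n - 1 \<Longrightarrow> psi xs (u + v) = psi xs u + psi xs v"
  using psi_linear by (simp add: Vector_Spaces.linear_iff)

lemma psi_scale: "length xs = n - 1 \<Longrightarrow> psi xs (sM c u) = sM c (psi xs u)"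
  using psi_linear by (simp add: Vector_Spaces.linear_iff)

lemma psi_sum: "length xs = n - 1 \<Longrightarrow> psi xs (\<Sum>i\<in>I. g i) = (\<Sum>i\<in>I. psi xs (g i))"
  using psi_linear linear_iff_module_hom module_hom.sum by blast

text \<open>The vectors \<open>u i\<close> are kept apart from \<open>xs\<close>, so that one sum
  serves for the extended bracket, for the cocycle identity and for \<open>theta_f\<close>.\<close>

definition alt_sum :: "'l list \<Rightarrow> (nat \<Rightarrow> 'm) \<Rightarrow> 'm" where
  "alt_sum xs u = (\<Sum>i<n. sM ((- 1) ^ (n - Suc i)) (psi (omit i xs) (u i)))"

lemma alt_sum_cong: "(\<And>i. i < n \<Longrightarrow> u i = v i) \<Longrightarrow> alt_sum xs u = alt_sum xs v"
  by (simp add: alt_sum_def)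

lemma alt_sum_add:
  "length xs = n \<Longrightarrow> alt_sum xs (\<lambda>i. u i + v i) = alt_sum xs u + alt_sum xs v"
  by (simp add: alt_sum_def psi_add M.scale_right_distrib sum.distrib)

text \<open>When slot \<open>i\<close> varies, the term that omits \<open>i\<close> sees only the
  \<open>M\<close>-component of the varying pair and every other term sees only its
  \<open>L\<close>-component. Each term is thus a linear map after a projection.\<close>

lemma alt_sum_multilinear:
  "multilinear n (\<lambda>c. map_prod (sL c) (sM c)) sM (\<lambda>zs. alt_sum (map fst zs) (\<lambda>i. snd (zs ! i)))"
  unfolding multilinear_def
proof (intro allI impI)
  fix zs :: "('l \<times> 'm) list" and i
  assume zs: "length zs = n" and i: "i < n"
  let ?s = "\<lambda>c. map_prod (sL c) (sM c)"
  note vs = L.L.vector_space_axioms M.vector_space_axioms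
  have "Vector_Spaces.linear ?s sM (\<lambda>z. sM ((- 1) ^ (n - Suc j))
      (psi (omit j (map fst (zs[i := z]))) (snd (zs[i := z] ! j))))" if j: "j < n" for j
  proof -
    have "Vector_Spaces.linear ?s sM (\<lambda>z. psi (omit j (map fst (zs[i := z]))) (snd (zs[i := z] ! j)))"
    proof (cases "j = i")
      case True
      have "Vector_Spaces.linear ?s sM (\<lambda>z. psi (omit i (map fst zs)) (snd z))"
        using linear_comp[OF linear_snd[OF vs] psi_linear] zs i by simp
      then show ?thesis using True zs i by (simp add: map_update)
    next
      case False
      let ?i = "if i < j then i else i - 1"
      have "Vector_Spaces.linear sL sM (\<lambda>x. psi ((omit j (map fst zs))[?i := x]) (snd (zs ! j)))"
        using zs i j False by (intro multilinearD[OF psi_multilinear]) auto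
      from linear_comp[OF linear_fst[OF vs] this] show ?thesis
        using zs i j False by (simp add: map_update omit_update)
    qed
    then show ?thesis
      using M.linear_scale_self linear_comp by blast
  qed
  then show "Vector_Spaces.linear ?s sM (\<lambda>z. alt_sum (map fst (zs[i := z])) (\<lambda>j. snd (zs[i := z] ! j)))"
    unfolding alt_sum_def
    by (intro linear_sum_fun vector_space_map_prod vs) auto
qed

text \<open>Under an adjacent swap the two terms that omit one of the swapped entries trade places,
  and their signs are opposite. In every other term both entries remain arguments of
  \<open>psi\<close>, whose skew symmetry gives the sign.\<close>

lemma alt_sum_skew:
  "skew_symmetric n (\<lambda>zs. alt_sum (map fst zs) (\<lambda>i. snd (zs ! i)))"
proof (rule skew_symmetricI_adjacent)
  fix zs :: "('l \<times> 'm) list" and i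
  assume zs: "length zs = n" and i: "Suc i < n"
  let ?zs = "zs[i := zs ! Suc i, Suc i := zs ! i]"
  let ?T = "\<lambda>zs j. sM ((- 1) ^ (n - Suc j)) (psi (omit j (map fst zs)) (snd (zs ! j)))"
  let ?t = "\<lambda>j. if j = i then Suc i else if j = Suc i then i else j"
  \<comment> \<open>\<open>Suc i < n\<close> keeps the truncated subtraction exact, so the exponents
    differ by one.\<close>
  have sign: "(- 1 :: 'k) ^ (n - Suc i) = - ((- 1) ^ (n - Suc (Suc i)))"
    using i by (metis Suc_diff_Suc power_Suc mult_minus1)
  have map_zs: "map fst ?zs =
      (map fst zs)[i := map fst zs ! Suc i, Suc i := map fst zs ! i]"
    using zs i by (simp add: map_update)
  have term_swap: "?T ?zs j = - ?T zs (?t j)" if j: "j < n" for j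
  proof -
    consider "j = i" | "j = Suc i" | "j \<noteq> i" "j \<noteq> Suc i" by blast
    then show ?thesis
    proof cases
      case 1
      then show ?thesis using zs i omit_swap_adjacent(1)[of i "map fst zs"]
        by (simp add: map_zs sign M.scale_minus_left)
    next
      case 2
      then show ?thesis using zs i omit_swap_adjacent(2)[of i "map fst zs"]
        by (simp add: map_zs sign M.scale_minus_left)
    next
      case 3
      \<comment> \<open>Entry \<open>j\<close> is not in the swapped pair, so the pair stays
        adjacent after its deletion; \<open>?i\<close> is where the pair then starts.\<close>
      let ?i = "if i < j then i else i - 1"
      let ?o = "omit j (map fst zs)"
      have "psi (omit j (map fst ?zs)) (snd (zs ! j)) =
          psi (?o[?i := ?o ! Suc ?i, Suc ?i := ?o ! ?i]) (snd (zs ! j))"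
      proof -
        have "omit j (map fst ?zs) = ?o[?i := ?o ! Suc ?i, Suc ?i := ?o ! ?i]"
          unfolding map_zs using zs i j 3
          by (intro nth_equalityI) (auto simp: nth_omit nth_list_update)
        then show ?thesis by simp
      qed
      also have "\<dots> = - psi ?o (snd (zs ! j))"
        using zs i j 3 by (intro skew_symmetricD[OF psi_skew]) auto
      finally show ?thesis using 3 by (simp add: M.scale_minus_right)
    qed
  qed
  have "alt_sum (map fst ?zs) (\<lambda>j. snd (?zs ! j)) = (\<Sum>j<n. - ?T zs (?t j))"
    unfolding alt_sum_def using term_swap by (intro sum.cong) auto
  also have "\<dots> = - (\<Sum>j<n. ?T zs (?t j))" by (simp only: sum_negf)
  \<comment> \<open>\<open>?t\<close> is its own inverse and maps the indices below \<open>n\<close>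
    to themselves.\<close>
  also have "(\<Sum>j<n. ?T zs (?t j)) = (\<Sum>j<n. ?T zs j)"
    using i by (intro sum.reindex_bij_witness[where i = ?t and j = ?t]) auto
  finally show "alt_sum (map fst ?zs) (\<lambda>j. snd (?zs ! j)) =
      - alt_sum (map fst zs) (\<lambda>j. snd (zs ! j))"
    by (simp add: alt_sum_def)
qed

text \<open>The part of \<open>alt_sum (xs @ [y]) u\<close> in which an entry of \<open>xs\<close>
  is omitted. The exponent still refers to all \<open>n\<close> arguments.\<close>

definition inner_sum :: "'l list \<Rightarrow> (nat \<Rightarrow> 'm) \<Rightarrow> 'l \<Rightarrow> 'm" where
  "inner_sum xs u y = (\<Sum>j<n - 1. sM ((- 1) ^ (n - Suc j)) (psi (omit j xs @ [y]) (u j)))"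

text \<open>The term with index \<open>n - 1\<close> omits \<open>y\<close> itself, and its sign has
  exponent \<open>0\<close>.\<close>

lemma alt_sum_snoc:
  assumes "n \<ge> 1" and "length xs = n - 1"
  shows "alt_sum (xs @ [y]) u = inner_sum xs u y + psi xs (u (n - 1))"
proof -
  have "{..<n} = insert (n - 1) {..<n - 1}" using assms by auto
  then show ?thesis using assms
    by (simp add: alt_sum_def inner_sum_def)
qed

text \<open>The second axiom of a representation expands each
  \<open>psi (omit j xs @ [br ys])\<close>; exchanging the two sums then collects the terms by the
  omitted entry of \<open>ys\<close>.\<close>

lemma inner_sum_bracket:
  assumes n: "n \<ge> 2" and xs: "length xs = n - 1" and ys: "length ys = n"
  shows "inner_sum xs u (br ys) = alt_sum ys (\<lambda>i. inner_sum xs u (ys ! i))"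
proof -
  have "inner_sum xs u (br ys) = (\<Sum>j<n - 1. \<Sum>i<n. sM ((- 1) ^ (n - Suc i))
      (psi (omit i ys) (sM ((- 1) ^ (n - Suc j)) (psi (omit j xs @ [ys ! i]) (u j)))))"
    unfolding inner_sum_def
  proof (rule sum.cong)
    fix j assume "j \<in> {..<n - 1}"
    then have len: "length (omit j xs) = n - 2" using xs by simp
    show "sM ((- 1) ^ (n - Suc j)) (psi (omit j xs @ [br ys]) (u j)) =
        (\<Sum>i<n. sM ((- 1) ^ (n - Suc i))
          (psi (omit i ys) (sM ((- 1) ^ (n - Suc j)) (psi (omit j xs @ [ys ! i]) (u j)))))"
      unfolding psi_bracket[OF len ys] M.scale_sum_right
      using ys by (intro sum.cong) (auto simp: psi_scale mult.commute)
  qed simp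
  also have "\<dots> = alt_sum ys (\<lambda>i. inner_sum xs u (ys ! i))"
    unfolding alt_sum_def inner_sum_def
    using ys by (subst sum.swap) (auto intro!: sum.cong simp: psi_sum M.scale_sum_right)
  finally show ?thesis .
qed

text \<open>By the first axiom, \<open>psi xs\<close> acts on the sum as a derivation: on the
  vectors \<open>v i\<close> through \<open>psi\<close> and on the entries of \<open>ys\<close>
  through the bracket. One summand can carry both updates at \<open>i\<close>, because the term
  omitting \<open>i\<close> sees only the change in \<open>v\<close> and the other terms only the
  change in \<open>ys\<close>.\<close>

lemma psi_alt_sum:
  assumes xs: "length xs = n - 1" and ys: "length ys = n"
  shows "psi xs (alt_sum ys v) = (\<Sum>i<n. alt_sum (ys[i := br (xs @ [ys ! i])]) (v(i := psi xs (v i))))"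
proof -
  let ?b = "\<lambda>i. br (xs @ [ys ! i])"
  let ?sg = "\<lambda>k. (- 1) ^ (n - Suc k) :: 'k"
  let ?A = "\<lambda>i k. sM (?sg k) (psi (omit k (ys[i := ?b i])) (v k))"
  have split: "alt_sum (ys[i := ?b i]) (v(i := psi xs (v i))) =
      sM (?sg i) (psi (omit i ys) (psi xs (v i))) + (\<Sum>k\<in>{..<n} - {i}. ?A i k)" if "i < n" for i
    unfolding alt_sum_def using that by (subst sum.remove[of _ i]) auto
  have comm: "psi xs (psi (omit k ys) (v k)) = psi (omit k ys) (psi xs (v k)) +
      (\<Sum>i\<in>{..<n} - {k}. psi (omit k (ys[i := ?b i])) (v k))" if k: "k < n" for k
  proof -
    have "psi xs (psi (omit k ys) (v k)) - psi (omit k ys) (psi xs (v k)) =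
        (\<Sum>l<n - 1. psi ((omit k ys)[l := br (xs @ [omit k ys ! l])]) (v k))"
      using xs ys k by (intro psi_commutator) auto
    \<comment> \<open>Slot \<open>l\<close> of \<open>omit k ys\<close> is slot \<open>l\<close> or
      \<open>Suc l\<close> of \<open>ys\<close>, so updating it amounts to updating
      \<open>ys\<close> before the omission.\<close>
    also have "\<dots> = (\<Sum>l<n - 1. (\<lambda>i. psi (omit k (ys[i := ?b i])) (v k)) (if l < k then l else Suc l))"
      using ys k by (intro sum.cong) (auto simp: nth_omit omit_update)
    also have "\<dots> = (\<Sum>i\<in>{..<n} - {k}. psi (omit k (ys[i := ?b i])) (v k))"
      by (rule sum_skip[OF k])
    finally show ?thesis by (simp add: algebra_simps)
  qed
  have "psi xs (alt_sum ys v) = (\<Sum>k<n. sM (?sg k) (psi xs (psi (omit k ys) (v k))))"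
    using xs by (simp add: alt_sum_def psi_sum psi_scale)
  also have "\<dots> = (\<Sum>k<n. sM (?sg k) (psi (omit k ys) (psi xs (v k))) + (\<Sum>i\<in>{..<n} - {k}. ?A i k))"
    by (intro sum.cong) (auto simp: comm M.scale_right_distrib M.scale_sum_right)
  also have "\<dots> = (\<Sum>i<n. sM (?sg i) (psi (omit i ys) (psi xs (v i))))
      + (\<Sum>k<n. \<Sum>i\<in>{..<n} - {k}. ?A i k)"
    by (simp add: sum.distrib)
  \<comment> \<open>The restriction \<open>i \<noteq> k\<close> is symmetric, so the sums can be
    exchanged.\<close>
  also have "(\<Sum>k<n. \<Sum>i\<in>{..<n} - {k}. ?A i k) = (\<Sum>i<n. \<Sum>k\<in>{..<n} - {i}. ?A i k)"
    using sum.swap_restrict[of "{..<n}" "{..<n}" "\<lambda>k i. ?A i k" "\<lambda>k i. i \<noteq> k"]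
    by (simp add: set_diff_eq eq_commute)
  finally show ?thesis
    by (simp add: split sum.distrib)
qed

text \<open>The vector at \<open>i\<close> occurs only in the term that omits \<open>i\<close>, so
  one of its two summands can be split off there. What remains has the shape that
  \<open>psi_alt_sum\<close> produces.\<close>

lemma alt_sum_fun_upd_add:
  assumes "length ys = n" and "i < n"
  shows "alt_sum ys (v(i := a + b)) =
    sM ((- 1) ^ (n - Suc i)) (psi (omit i ys) a) + alt_sum ys (v(i := b))"
  using assms unfolding alt_sum_def
  by (simp add: sum.remove[of _ i] psi_add M.scale_right_distrib algebra_simps)

text \<open>The bracket of \<open>T_extension\<close>, expressed through the \<open>n\<close>-Lie
  algebra and its representation alone: the fundamental identity does not involve the module
  structure over \<open>A\<close>.\<close>

definition ext_bracket :: "('l list \<Rightarrow> 'm) \<Rightarrow> ('l \<times> 'm) list \<Rightarrow> 'l \<times> 'm" where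
  "ext_bracket \<theta> zs =
    (br (map fst zs), \<theta> (map fst zs) + alt_sum (map fst zs) (\<lambda>i. snd (zs ! i)))"

lemma ext_bracket_multilinear:
  assumes "multilinear n sL sM \<theta>"
  shows "multilinear n (\<lambda>c. map_prod (sL c) (sM c)) (\<lambda>c. map_prod (sL c) (sM c)) (ext_bracket \<theta>)"
  unfolding multilinear_def
proof (intro allI impI)
  fix zs :: "('l \<times> 'm) list" and i
  assume zs: "length zs = n" and i: "i < n"
  let ?s = "\<lambda>c. map_prod (sL c) (sM c)"
  note vs = L.L.vector_space_axioms M.vector_space_axioms
  have "Vector_Spaces.linear ?s sL (\<lambda>z. br (map fst (zs[i := z])))"
    and "Vector_Spaces.linear ?s sM (\<lambda>z. \<theta> (map fst (zs[i := z])))"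
    using multilinearD[OF multilinear_map[OF L.br_multilinear linear_fst[OF vs]] zs i]
      multilinearD[OF multilinear_map[OF assms linear_fst[OF vs]] zs i] by simp_all
  then show "Vector_Spaces.linear ?s ?s (\<lambda>z. ext_bracket \<theta> (zs[i := z]))"
    using multilinearD[OF alt_sum_multilinear zs i]
    by (simp add: Vector_Spaces.linear_iff ext_bracket_def M.scale_right_distrib algebra_simps)
qed

lemma ext_bracket_skew:
  assumes "skew_symmetric n \<theta>"
  shows "skew_symmetric n (ext_bracket \<theta>)"
  unfolding skew_symmetric_def
proof (intro allI impI)
  fix zs :: "('l \<times> 'm) list" and i j
  assume *: "length zs = n" "i < n" "j < n" "i \<noteq> j"
  show "ext_bracket \<theta> (zs[i := zs ! j, j := zs ! i]) = - ext_bracket \<theta> zs"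
    using skew_symmetricD[OF skew_symmetric_map[OF L.br_skew] *]
      skew_symmetricD[OF skew_symmetric_map[OF assms] *] skew_symmetricD[OF alt_sum_skew *]
    by (simp add: ext_bracket_def)
qed

lemma ext_bracket_fundamental:
  assumes n: "n \<ge> 2"
    and cocycle: "\<And>xs ys. length xs = n - 1 \<Longrightarrow> length ys = n \<Longrightarrow>
      \<theta> (xs @ [br ys]) = (\<Sum>i<n. \<theta> (ys[i := br (xs @ [ys ! i])])) +
        alt_sum ys (\<lambda>i. \<theta> (xs @ [ys ! i])) - psi xs (\<theta> ys)"
    and zs: "length zs = n - 1" and ws: "length ws = n"
  shows "ext_bracket \<theta> (zs @ [ext_bracket \<theta> ws]) =
    (\<Sum>i<n. ext_bracket \<theta> (ws[i := ext_bracket \<theta> (zs @ [ws ! i])]))"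
proof -
  \<comment> \<open>\<open>X\<close> and \<open>u\<close> are the components of the first
    \<open>n - 1\<close> arguments, \<open>Y\<close> and \<open>v\<close> those of the bracketed
    ones.\<close>
  define X Y u v where "X = map fst zs" and "Y = map fst ws"
    and "u = (\<lambda>j. snd (zs ! j))" and "v = (\<lambda>i. snd (ws ! i))"
  define t where "t i = br (X @ [Y ! i])" for i
  have X: "length X = n - 1" and Y: "length Y = n"
    using zs ws by (simp_all add: X_def Y_def)
  \<comment> \<open>The sum stops before the last position, so the appended \<open>w\<close> is
    never read.\<close>
  have inner_cong: "inner_sum X (\<lambda>j. snd ((zs @ [w]) ! j)) y = inner_sum X u y" for w y
    using zs by (simp add: inner_sum_def u_def nth_append)
  have snoc: "ext_bracket \<theta> (zs @ [w]) = (br (X @ [fst w]),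
      \<theta> (X @ [fst w]) + (inner_sum X u (fst w) + psi X (snd w)))" for w
    using n X zs nth_append_length[of zs w "[]"]
    by (simp add: ext_bracket_def alt_sum_snoc inner_cong flip: X_def)
  have upd: "ext_bracket \<theta> (ws[i := (t i, a)]) =
      (br (Y[i := t i]), \<theta> (Y[i := t i]) + alt_sum (Y[i := t i]) (v(i := a)))" if "i < n" for i a
  proof -
    have "alt_sum (Y[i := t i]) (\<lambda>j. snd (ws[i := (t i, a)] ! j)) = alt_sum (Y[i := t i]) (v(i := a))"
      using that ws by (intro alt_sum_cong) (simp add: v_def nth_list_update)
    then show ?thesis by (simp add: ext_bracket_def map_update Y_def)
  qed
  \<comment> \<open>The inner bracket with \<open>ws ! i\<close> has \<open>M\<close>-component
    \<open>?c i + psi X (v i)\<close>. Over all \<open>i\<close>, the parts \<open>?c i\<close> add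
    up to \<open>alt_sum Y ?c\<close>, and the rest is the right-hand side of
    \<open>psi_alt_sum\<close>.\<close>
  let ?c = "\<lambda>i. \<theta> (X @ [Y ! i]) + inner_sum X u (Y ! i)"
  have summand: "ext_bracket \<theta> (ws[i := ext_bracket \<theta> (zs @ [ws ! i])]) = (br (Y[i := t i]),
      \<theta> (Y[i := t i]) + (sM ((- 1) ^ (n - Suc i)) (psi (omit i Y) (?c i)) +
        alt_sum (Y[i := t i]) (v(i := psi X (v i)))))" if i: "i < n" for i
  proof -
    have "ext_bracket \<theta> (zs @ [ws ! i]) = (t i, ?c i + psi X (v i))"
      using i ws by (simp add: snoc t_def Y_def v_def add.assoc)
    then show ?thesis
      using i Y by (simp only: upd[OF i] alt_sum_fun_upd_add length_list_update omit_update_same)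
  qed
  have "(\<Sum>i<n. ext_bracket \<theta> (ws[i := ext_bracket \<theta> (zs @ [ws ! i])])) =
      ((\<Sum>i<n. br (Y[i := t i])), (\<Sum>i<n. \<theta> (Y[i := t i])) + (alt_sum Y ?c +
        (\<Sum>i<n. alt_sum (Y[i := t i]) (v(i := psi X (v i))))))"
    by (simp add: summand sum_prod sum.distrib alt_sum_def)
  also have "(\<Sum>i<n. alt_sum (Y[i := t i]) (v(i := psi X (v i)))) = psi X (alt_sum Y v)"
    using psi_alt_sum[OF X Y] by (simp add: t_def)
  also have "alt_sum Y ?c = alt_sum Y (\<lambda>i. \<theta> (X @ [Y ! i])) + inner_sum X u (br Y)"
    by (simp add: alt_sum_add[OF Y] inner_sum_bracket[OF n X Y])
  also have "(\<Sum>i<n. br (Y[i := t i])) = br (X @ [br Y])"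
    by (simp add: L.br_fundamental[OF X Y] t_def)
  also have "(\<Sum>i<n. \<theta> (Y[i := t i])) =
      \<theta> (X @ [br Y]) - alt_sum Y (\<lambda>i. \<theta> (X @ [Y ! i])) + psi X (\<theta> Y)"
    by (simp add: cocycle[OF X Y] t_def)
  finally show ?thesis
    unfolding snoc using X by (simp add: ext_bracket_def psi_add flip: Y_def v_def)
qed

end

section \<open>The extension as an n-Lie Rinehart algebra\<close>

context n_Lie_Rinehart_rep
begin

text \<open>Linearity over \<open>A\<close> is an axiom for the first slot. Exchanging the first and
  last entries before and after carries it to the last slot, and the two signs cancel.\<close>

lemma action_act_snoc:
  assumes "length (xs @ [x]) = n - 1"
  shows "action P (xs @ [actL R a x]) m = actM P a (action P (xs @ [x]) m)"
proof (cases xs)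
  case Nil
  then show ?thesis using assms action_act[of x "[]"] by simp
next
  case (Cons y ys)
  have swap: "action P (z # ys @ [y]) m = - action P (xs @ [z]) m" for z
  proof -
    have "(xs @ [z])[0 := (xs @ [z]) ! length xs, length xs := (xs @ [z]) ! 0] = z # ys @ [y]"
      by (simp add: Cons nth_append)
    then show ?thesis
      using skew_symmetricD[OF P.psi_skew[of m], of "xs @ [z]" 0 "length xs"] assms
      by (simp add: Cons)
  qed
  have "action P (actL R a x # ys @ [y]) m = actM P a (action P (x # ys @ [y]) m)"
    using assms Cons by (intro action_act) auto
  moreover have "actM P a (- v) = - actM P a v" for v
    using M.act_add_right[of a v "- v"] M.act_add_right[of a 0 0]
    by (simp add: add_eq_0_iff)
  ultimately show ?thesis by (simp add: swap)
qed

lemma actM_sum: "actM P a (\<Sum>i\<in>I. g i) = (\<Sum>i\<in>I. actM P a (g i))"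
  using M.act_add_right[of a 0 0]
  by (induction I rule: infinite_finite_induct) (auto simp: M.act_add_right)

lemma T_extension_eq: "T_extension n R P \<theta> =
    \<lparr>scaleA = scaleA R, scaleL = (\<lambda>c. map_prod (scaleL R c) (scaleM P c)),
     actL = (\<lambda>a. map_prod (actL R a) (actM P a)), bracket = P.ext_bracket \<theta>,
     anchor = (\<lambda>zs. anchor R (map fst zs))\<rparr>"
  by (simp add: T_extension_def P.ext_bracket_def[abs_def] P.alt_sum_def)

lemma T_extension_module:
  "algebra_module (scaleA R) (\<lambda>c. map_prod (scaleL R c) (scaleM P c))
    (\<lambda>a. map_prod (actL R a) (actM P a))"
proof (intro algebra_module.intro algebra_module_axioms.intro vector_space_map_prod)
  show "map_prod (actL R e) (actM P e) v = v" if "\<forall>a. e * a = a" for e v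
    using that R.act_unit M.act_unit by (simp add: prod_eq_iff)
qed (simp_all add: R.A.comm_algebra_axioms R.V.vector_space_axioms M.V.vector_space_axioms prod_eq_iff
    R.act_add_left M.act_add_left R.act_add_right M.act_add_right R.act_scale_left M.act_scale_left
    R.act_scale_right M.act_scale_right R.act_mult M.act_mult)

lemma T_extension_n_Lie_algebra:
  assumes "n \<ge> 2" and "cocycle2 n R P \<theta>"
  shows "n_Lie_algebra n (\<lambda>c. map_prod (scaleL R c) (scaleM P c)) (P.ext_bracket \<theta>)"
  by (intro n_Lie_algebra.intro n_Lie_algebra_axioms.intro vector_space_map_prod
      P.ext_bracket_multilinear P.ext_bracket_skew P.ext_bracket_fundamental)
    (use assms in \<open>auto simp: cocycle2_def cochain2_def P.alt_sum_def
      R.V.vector_space_axioms M.V.vector_space_axioms\<close>)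

text \<open>The anchor sees only \<open>L\<close>-components, and \<open>fst\<close> carries the
  extended bracket to the bracket of \<open>L\<close>. Each axiom is therefore pulled back along
  \<open>fst\<close>.\<close>

lemma T_extension_n_Lie_rep:
  assumes "n \<ge> 2" and "cocycle2 n R P \<theta>"
  shows "n_Lie_rep n (\<lambda>c. map_prod (scaleL R c) (scaleM P c)) (P.ext_bracket \<theta>)
    (scaleA R) (\<lambda>zs. anchor R (map fst zs))"
proof (intro n_Lie_rep.intro n_Lie_rep_axioms.intro T_extension_n_Lie_algebra assms)
  show "multilinear (n - 1) (\<lambda>c. map_prod (scaleL R c) (scaleM P c)) (scaleA R)
      (\<lambda>zs. anchor R (map fst zs) a)" for a
    by (intro multilinear_map[OF R.psi_multilinear] linear_fst
        R.V.vector_space_axioms M.V.vector_space_axioms)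
  show "skew_symmetric (n - 1) (\<lambda>zs. anchor R (map fst zs) a)" for a
    by (rule skew_symmetric_map[OF R.psi_skew])
  fix zs ws :: "('l \<times> 'm) list" and a
  show "anchor R (map fst zs) (anchor R (map fst ws) a) - anchor R (map fst ws) (anchor R (map fst zs) a) =
      (\<Sum>i<n - 1. anchor R (map fst (ws[i := P.ext_bracket \<theta> (zs @ [ws ! i])])) a)"
    if "length zs = n - 1" "length ws = n - 1"
    using that R.psi_commutator[of "map fst zs" "map fst ws" a]
    by (simp add: map_update P.ext_bracket_def)
  show "anchor R (map fst (zs @ [P.ext_bracket \<theta> ws])) a =
      (\<Sum>i<n. scaleA R ((- 1) ^ (n - Suc i))
        (anchor R (map fst (omit i ws)) (anchor R (map fst (zs @ [ws ! i])) a)))"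
    if "length zs = n - 2" "length ws = n"
    using that R.psi_bracket[of "map fst zs" "map fst ws" a]
    by (simp add: map_omit P.ext_bracket_def)
qed (simp_all add: R.psi_linear R.A.vector_space_axioms)

text \<open>The Leibniz rule of the bracket is the substantial axiom. In the last slot
  \<open>\<theta>\<close> and \<open>inner_sum\<close> are linear over \<open>A\<close>; the
  derivation terms come from the bracket of \<open>L\<close> applied to \<open>x\<close> and from
  \<open>action P X\<close> applied to \<open>m\<close>.\<close>

lemma T_extension_n_Lie_Rinehart:
  assumes n: "n \<ge> 2" and \<theta>: "cocycle2 n R P \<theta>"
  shows "n_Lie_Rinehart n (T_extension n R P \<theta>)"
  unfolding T_extension_eq
proof (intro n_Lie_Rinehart.intro n_Lie_Rinehart_axioms.intro, unfold lie_rinehart.simps)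
  fix a and z :: "'l \<times> 'm" and zs :: "('l \<times> 'm) list"
  assume zs: "length zs = n - 1"
  obtain x m where z: "z = (x, m)" by (cases z)
  define X u where "X = map fst zs" and "u = (\<lambda>j. snd (zs ! j))"
  have X: "length X = n - 1" using zs by (simp add: X_def)
  have inner_cong: "P.inner_sum X (\<lambda>j. snd ((zs @ [w]) ! j)) y = P.inner_sum X u y" for w y
    using zs by (simp add: P.inner_sum_def u_def nth_append)
  have snoc: "P.ext_bracket \<theta> (zs @ [(y, k)]) =
      (bracket R (X @ [y]), \<theta> (X @ [y]) + (P.inner_sum X u y + action P X k))" for y k
    using n X zs nth_append_length[of zs "(y, k)" "[]"]
    by (simp add: P.ext_bracket_def P.alt_sum_snoc inner_cong flip: X_def)
  have "P.inner_sum X u (actL R a x) = actM P a (P.inner_sum X u x)"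
    unfolding P.inner_sum_def actM_sum
    using X by (intro sum.cong) (auto simp: action_act_snoc M.act_scale_right)
  moreover have "\<theta> (X @ [actL R a x]) = actM P a (\<theta> (X @ [x]))"
  proof -
    have "\<theta> ((X @ [x])[length X := actL R a ((X @ [x]) ! length X)]) = actM P a (\<theta> (X @ [x]))"
      using \<theta> n X unfolding cocycle2_def cochain2_def by simp
    then show ?thesis by simp
  qed
  ultimately show "P.ext_bracket \<theta> (zs @ [map_prod (actL R a) (actM P a) z]) =
      map_prod (actL R a) (actM P a) (P.ext_bracket \<theta> (zs @ [z])) +
      map_prod (actL R (anchor R (map fst zs) a)) (actM P (anchor R (map fst zs) a)) z"
    using X by (simp add: z snoc R.bracket_act action_leibniz M.act_add_right flip: X_def)
qed (use n \<theta> in \<open>auto simp: T_extension_module T_extension_n_Lie_rep R.anchor_derivation R.anchor_act\<close>)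

end

section \<open>Transport of structure along a linear bijection\<close>

lemma n_Lie_Rinehart_transport:
  fixes R :: "('k::field_char_0, 'a::comm_ring, 'l::ab_group_add) lie_rinehart"
    and R' :: "('k, 'a, 'h::ab_group_add) lie_rinehart"
  assumes n: "n \<ge> 2" and "n_Lie_Rinehart n R"
    and "bij \<phi>"
    and linear: "Vector_Spaces.linear (scaleL R) (scaleL R') \<phi>"
    and scaleA: "scaleA R' = scaleA R"
    and act: "\<And>a x. \<phi> (actL R a x) = actL R' a (\<phi> x)"
    and br: "\<And>xs. length xs = n \<Longrightarrow> \<phi> (bracket R xs) = bracket R' (map \<phi> xs)"
    and anc: "\<And>xs. length xs = n - 1 \<Longrightarrow> anchor R xs = anchor R' (map \<phi> xs)"
  shows "n_Lie_Rinehart n R'"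
proof -
  interpret R: n_Lie_Rinehart n R by fact
  define g where "g = inv \<phi>"
  have \<phi>g: "\<phi> (g y) = y" and g\<phi>: "g (\<phi> x) = x" for x y
    using \<open>bij \<phi>\<close> by (simp_all add: g_def bij_is_surj bij_is_inj surj_f_inv_f)
  \<comment> \<open>\<open>Vector_Spaces.linear\<close> contains the vector space axioms for both
    sides, so those of the target come from \<open>linear\<close>.\<close>
  have vs: "vector_space (scaleL R')" and \<phi>_add: "\<phi> (x + y) = \<phi> x + \<phi> y"
    and \<phi>_scale: "\<phi> (scaleL R c x) = scaleL R' c (\<phi> x)" for c x y
    using linear by (simp_all add: Vector_Spaces.linear_iff)
  have \<phi>_sum: "\<phi> (\<Sum>i\<in>I. h i) = (\<Sum>i\<in>I. \<phi> (h i))" for I :: "nat set" and h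
    using linear linear_iff_module_hom module_hom.sum by blast
  have g_add: "g (x + y) = g x + g y" and g_scale: "g (scaleL R' c x) = scaleL R c (g x)" for c x y
    using \<phi>_add[of "g x" "g y"] \<phi>_scale[of c "g x"] g\<phi> \<phi>g by metis+
  have g_linear: "Vector_Spaces.linear (scaleL R') (scaleL R) g"
    using vs R.V.vector_space_axioms by (simp add: Vector_Spaces.linear_iff g_add g_scale)
  have map_g: "map \<phi> (map g xs) = xs" for xs
    by (simp add: \<phi>g o_def)
  \<comment> \<open>The operations of \<open>R'\<close> are now conjugates of those of
    \<open>R\<close>. Each axiom below becomes the axiom of \<open>R\<close> at the arguments mapped
    by \<open>g\<close>.\<close>
  have br': "bracket R' xs = \<phi> (bracket R (map g xs))" if "length xs = n" for xs
    using br[of "map g xs"] that by (simp only: map_g length_map)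
  have anc': "anchor R' xs = anchor R (map g xs)" if "length xs = n - 1" for xs
    using anc[of "map g xs"] that by (simp only: map_g length_map)
  have act': "actL R' a x = \<phi> (actL R a (g x))" for a x
    by (simp add: act \<phi>g)
  have br'_multilinear: "multilinear n (scaleL R') (scaleL R') (bracket R')"
    unfolding multilinear_def
  proof (intro allI impI)
    fix xs :: "'h list" and i assume "length xs = n" "i < n"
    then show "Vector_Spaces.linear (scaleL R') (scaleL R') (\<lambda>z. bracket R' (xs[i := z]))"
      using linear_comp[OF multilinearD[OF multilinear_map[OF R.L.br_multilinear g_linear]] linear]
      by (simp add: br')
  qed
  have br'_skew: "skew_symmetric n (bracket R')"
    unfolding skew_symmetric_def
  proof (intro allI impI)
    fix xs :: "'h list" and i j assume *: "length xs = n" "i < n" "j < n" "i \<noteq> j"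
    have "\<phi> (- x) = - \<phi> x" for x
      using linear linear_iff_module_hom module_hom.neg by blast
    then show "bracket R' (xs[i := xs ! j, j := xs ! i]) = - bracket R' xs"
      using skew_symmetricD[OF skew_symmetric_map[OF R.L.br_skew, where g = g] *] *
      by (simp add: br')
  qed
  show ?thesis
  proof (intro n_Lie_Rinehart.intro n_Lie_Rinehart_axioms.intro algebra_module.intro
      algebra_module_axioms.intro n_Lie_rep.intro n_Lie_rep_axioms.intro n_Lie_algebra.intro
      n_Lie_algebra_axioms.intro, unfold scaleA)
    show "actL R' e v = v" if "\<forall>a. e * a = a" for e v
      using that R.act_unit by (simp add: act' \<phi>g)
    show "bracket R' (xs @ [bracket R' ys]) = (\<Sum>i<n. bracket R' (ys[i := bracket R' (xs @ [ys ! i])]))"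
      if "length xs = n - 1" "length ys = n" for xs ys
      using that n R.L.br_fundamental[of "map g xs" "map g ys"]
      by (simp add: br' map_update g\<phi> \<phi>_sum)
    show "multilinear (n - 1) (scaleL R') (scaleA R) (\<lambda>xs. anchor R' xs a)" for a
      unfolding multilinear_def
    proof (intro allI impI)
      fix xs :: "'h list" and i assume "length xs = n - 1" "i < n - 1"
      then show "Vector_Spaces.linear (scaleL R') (scaleA R) (\<lambda>z. anchor R' (xs[i := z]) a)"
        using multilinearD[OF multilinear_map[OF R.psi_multilinear g_linear]]
        by (simp add: anc')
    qed
    show "skew_symmetric (n - 1) (\<lambda>xs. anchor R' xs a)" for a
      unfolding skew_symmetric_def
    proof (intro allI impI)
      fix xs :: "'h list" and i j assume *: "length xs = n - 1" "i < n - 1" "j < n - 1" "i \<noteq> j"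
      show "anchor R' (xs[i := xs ! j, j := xs ! i]) a = - anchor R' xs a"
        using skew_symmetricD[OF skew_symmetric_map[OF R.psi_skew, where g = g] *] *
        by (simp add: anc')
    qed
    show "anchor R' xs (anchor R' ys a) - anchor R' ys (anchor R' xs a) =
        (\<Sum>i<n - 1. anchor R' (ys[i := bracket R' (xs @ [ys ! i])]) a)"
      if "length xs = n - 1" "length ys = n - 1" for xs ys a
      using that R.psi_commutator[of "map g xs" "map g ys" a]
      by (simp add: br' anc' map_update g\<phi>)
    \<comment> \<open>As \<open>n \<ge> 2\<close>, appending one entry to a list of length
      \<open>n - 2\<close> gives length exactly \<open>n - 1\<close>, so \<open>anc'\<close>
      applies.\<close>
    show "anchor R' (xs @ [bracket R' ys]) a =
        (\<Sum>i<n. scaleA R ((- 1) ^ (n - Suc i)) (anchor R' (omit i ys) (anchor R' (xs @ [ys ! i]) a)))"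
      if "length xs = n - 2" "length ys = n" for xs ys a
      using that n R.psi_bracket[of "map g xs" "map g ys" a]
      by (simp add: br' anc' map_omit g\<phi>)
    show "anchor R' (actL R' a x # xs) b = a * anchor R' (x # xs) b"
      if "length (x # xs) = n - 1" for a b x xs
      using that R.anchor_act[of "g x" "map g xs" a b] by (simp add: anc' act' g\<phi>)
    show "bracket R' (xs @ [actL R' a x]) =
        actL R' a (bracket R' (xs @ [x])) + actL R' (anchor R' xs a) x"
      if "length xs = n - 1" for a x xs
      using that n R.bracket_act[of "map g xs" a "g x"] by (simp add: br' anc' act' g\<phi> \<phi>_add)
  qed (simp_all add: vs br'_multilinear br'_skew anc' act' \<phi>g g\<phi> g_add \<phi>_add g_scale \<phi>_scale
      R.A.comm_algebra_axioms R.A.vector_space_axioms R.psi_linear R.anchor_derivation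
      R.act_add_left R.act_add_right R.act_scale_left R.act_scale_right R.act_mult)
qed

section \<open>The isomorphism between the two extensions\<close>

theorem theorem5p7:
  fixes n :: nat
    and R :: "('k::field_char_0, 'a::comm_ring, 'l::ab_group_add) lie_rinehart"
    and P :: "('k, 'a, 'l, 'm::ab_group_add) lie_rinehart_rep"
    and \<theta> :: "'l list \<Rightarrow> 'm" and f :: "'l \<Rightarrow> 'm"
  assumes "n \<ge> 2"
    and "n_Lie_Rinehart n R"
    and "n_Lie_Rinehart_rep n R P"
    and "cocycle2 n R P \<theta>"
    and "cochain1 R P f"
  shows "n_Lie_Rinehart_iso n
    (T_extension n R P \<theta>)
    (T_extension n R P (\<lambda>xs. \<theta> xs + theta_f n R P f xs))
    (\<lambda>(x, m). (x, f x + m)) id"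
proof -
  interpret n_Lie_Rinehart_rep n R P by fact
  let ?\<Phi> = "\<lambda>(x, m). (x, f x + m)"
  let ?T = "T_extension n R P \<theta>"
  let ?T' = "T_extension n R P (\<lambda>xs. \<theta> xs + theta_f n R P f xs)"
  have bij: "bij ?\<Phi>"
    by (rule o_bij[where g = "\<lambda>(x, m). (x, m - f x)"]) (auto simp: fun_eq_iff)
  have T: "n_Lie_Rinehart n ?T"
    using T_extension_n_Lie_Rinehart assms by blast
  have f: "f (x + y) = f x + f y" "f (scaleL R c x) = scaleM P c (f x)"
    "f (actL R a x) = actM P a (f x)" for x y c a
    using assms(5) by (simp_all add: cochain1_def Vector_Spaces.linear_iff)
  have linear: "Vector_Spaces.linear (scaleL ?T) (scaleL ?T') ?\<Phi>"
    using vector_space_map_prod[OF R.V.vector_space_axioms M.V.vector_space_axioms]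
    by (auto simp: Vector_Spaces.linear_iff T_extension_eq f M.V.scale_right_distrib)
  have act: "?\<Phi> (actL ?T a z) = actL ?T' a (?\<Phi> z)" for a z
    by (cases z) (simp add: T_extension_eq f M.act_add_right)
  have map_fst: "map fst (map ?\<Phi> zs) = map fst zs" for zs
    by (simp add: case_prod_beta o_def)
  have br: "?\<Phi> (bracket ?T zs) = bracket ?T' (map ?\<Phi> zs)" if zs: "length zs = n" for zs
  proof -
    let ?X = "map fst zs"
    \<comment> \<open>\<open>\<Phi>\<close> adds \<open>f (?X ! i)\<close> to each
      \<open>M\<close>-component. The resulting extra sum is exactly the one that
      \<open>theta_f\<close> subtracts, which leaves \<open>f (bracket R ?X)\<close>, the shift that
      \<open>\<Phi>\<close> applies to the bracket.\<close>
    have "P.alt_sum ?X (\<lambda>i. snd (map ?\<Phi> zs ! i)) = P.alt_sum ?X (\<lambda>i. f (?X ! i) + snd (zs ! i))"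
      using zs by (intro P.alt_sum_cong) (simp add: case_prod_beta)
    also have "\<dots> = P.alt_sum ?X (\<lambda>i. f (?X ! i)) + P.alt_sum ?X (\<lambda>i. snd (zs ! i))"
      using zs by (intro P.alt_sum_add) simp
    finally show ?thesis
      by (simp add: T_extension_eq P.ext_bracket_def map_fst theta_f_def P.alt_sum_def
          del: map_map)
  qed
  have anc: "anchor ?T zs = anchor ?T' (map ?\<Phi> zs)" for zs
    by (simp add: T_extension_eq map_fst del: map_map)
  have A: "scaleA ?T' = scaleA ?T" "scaleA ?T = scaleA R"
    by (simp_all add: T_extension_eq)
  have T': "n_Lie_Rinehart n ?T'"
    using n_Lie_Rinehart_transport[OF _ T bij linear A(1) act br anc] assms(1) by simp
  have "n_Lie_Rinehart_hom n ?T ?T' ?\<Phi> id"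
    unfolding n_Lie_Rinehart_hom_def
    using T T' linear act br anc A R.A.linear_id by (simp add: id_def)
  then show ?thesis
    using bij by (simp add: n_Lie_Rinehart_iso_def)
qed

end
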